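(* Let $\bar x\notin\Omega$ with $T^F_\Omega(\bar x)<\infty$. Then for every $\varepsilon\ge 0$, every $x^*\in\widehat\partial_\varepsilon T^F_\Omega(\bar x)$, and every $\eta>0$ there is $\bar w\in\Omega$ such that $$x^*\in\widehat N_{\varepsilon+\eta}(\bar w;\Omega)\quad\text{and}\quad \|\bar x-\bar w\|\le\|F\|\,T^F_\Omega(\bar x)+\eta.$$
   Context: $X$ is an arbitrary (real) Banach space with topological dual $X^*$ and pairing $\langle\cdot,\cdot\rangle$. Standing assumptions: $\Omega\subset X$ is nonempty and closed; $F\subset X$ is nonempty, closed, bounded and convex (it is not assumed that $0\in\mathrm{int}\,F$). The minimal time function is $T^F_\Omega(x):=\inf\{t\ge 0\mid \Omega\cap(x+tF)\ne\emptyset\}\in[0,\infty]$, with $\inf\emptyset=\infty$. Put $\|F\|:=\sup\{\|q\|\mid q\in F\}$. For $\varepsilon\ge0$ and a set $\Theta\subset X$, the set of $\varepsilon$-normals to $\Theta$ at $\bar x\in\Theta$ is $\widehat N_\varepsilon(\bar x;\Theta):=\{x^*\in X^*\mid \limsup_{x\to\bar x,\,x\in\Theta}\frac{\langle x^*,x-\bar x\rangle}{\|x-\bar x\|}\le\varepsilon\}$, and $\widehat N_\varepsilon(\bar x;\Theta):=\emptyset$ if $\bar x\notin\Theta$. For $\varphi:X\to(-\infty,\infty]$ and $\bar x$ with $\varphi(\bar x)<\infty$, the $\varepsilon$-subdifferential is $\widehat\partial_\varepsilon\varphi(\bar x):=\{x^*\in X^*\mid\liminf_{x\to\bar x}\frac{\varphi(x)-\varphi(\bar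 x)-\langle x^*,x-\bar x\rangle}{\|x-\bar x\|}\ge-\varepsilon\}$. *)

theory Defs
  imports "HOL-Analysis.Analysis"
begin

text \<open>The topological dual of \<open>'a\<close> is the type \<open>'a \<Rightarrow>\<^sub>L real\<close> of bounded linear functionals, and the
  pairing is \<^const>\<open>blinfun_apply\<close>.\<close>

text \<open>The infimum is taken in the extended reals, so it is \<open>\<infinity>\<close> over the empty set.\<close>

definition minimal_time :: "'a::real_normed_vector set \<Rightarrow> 'a set \<Rightarrow> 'a \<Rightarrow> ereal" where
  "minimal_time F \<Omega> x =
     (INF t\<in>{t::real. 0 \<le> t \<and> \<Omega> \<inter> (\<lambda>q. x + t *\<^sub>R q) ` F \<noteq> {}}. ereal t)"

text \<open>A supremum in the reals: meaningful for nonempty bounded \<open>F\<close>.\<close>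

definition set_norm :: "'a::real_normed_vector set \<Rightarrow> real" where
  "set_norm F = (SUP q\<in>F. norm q)"

text \<open>The filter \<open>at xb within \<Theta>\<close> excludes \<open>xb\<close> itself. At an isolated point of \<open>\<Theta>\<close> the upper limit
  is \<open>-\<infinity>\<close>, so every functional is then an \<open>\<epsilon>\<close>-normal.\<close>

definition eps_normals ::
  "real \<Rightarrow> 'a::real_normed_vector \<Rightarrow> 'a set \<Rightarrow> ('a \<Rightarrow>\<^sub>L real) set" where
  "eps_normals \<epsilon> xb \<Theta> =
     (if xb \<in> \<Theta> then
        {xs. Limsup (at xb within \<Theta>)
               (\<lambda>x. ereal (blinfun_apply xs (x - xb) / norm (x - xb))) \<le> ereal \<epsilon>}
      else {})"

text \<open>Intended for \<open>\<phi>\<close> with values in \<open>(-\<infinity>, \<infinity>]\<close>; as usual, the set is empty where \<open>\<phi>\<close> is not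
  finite.\<close>

definition eps_subdifferential ::
  "real \<Rightarrow> ('a::real_normed_vector \<Rightarrow> ereal) \<Rightarrow> 'a \<Rightarrow> ('a \<Rightarrow>\<^sub>L real) set" where
  "eps_subdifferential \<epsilon> \<phi> xb =
     (if \<bar>\<phi> xb\<bar> < \<infinity> then
        {xs. Liminf (at xb)
               (\<lambda>x. (\<phi> x - \<phi> xb - ereal (blinfun_apply xs (x - xb))) / ereal (norm (x - xb)))
             \<ge> ereal (- \<epsilon>)}
      else {})"

end

theory Submission
  imports Defs
begin

text \<open>
  Let \<open>T\<close> be the minimal time function and \<open>T0 = T xb\<close>. Any time \<open>t\<close> slightly larger than \<open>T0\<close> (by less than
  \<open>\<mu>\<^sup>2\<close>) comes with a velocity \<open>q \<in> F\<close> such that \<open>w0 = xb + t q\<close> lies in the target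
  \<open>\<Omega>\<close>; no exact projection of \<open>xb\<close> onto \<open>\<Omega>\<close> need exist. Every \<open>w \<in> \<Omega>\<close> is reached from \<open>w - t q\<close>
  within time \<open>t\<close>, so \<open>T (w - t q) \<le> t < T0 + \<mu>\<^sup>2\<close>. Since \<open>(w - t q) - xb = w - w0\<close>, the
  \<open>\<epsilon>\<close>-subgradient inequality at \<open>xb\<close>, with slack \<open>\<gamma> = \<eta>/2\<close> and translated by \<open>t q\<close>, says that \<open>w0\<close> minimises
  \<open>w \<mapsto> (\<epsilon> + \<gamma>) \<parallel>w - w0\<parallel> - \<langle>xs, w\<rangle>\<close> up to \<open>\<mu>\<^sup>2\<close> on the part of \<open>\<Omega>\<close> near \<open>w0\<close>.

  Ekeland's variational principle (\<open>Ekeland_variational_principle\<close>) moves \<open>w0\<close> by at most \<open>\<mu>\<close> to a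
  point \<open>wb\<close> that exactly minimises, on that part of \<open>\<Omega>\<close>, the same function perturbed by \<open>\<mu> \<parallel>w - wb\<parallel>\<close>. By the triangle
  inequality \<open>\<langle>xs, w - wb\<rangle> \<le> (\<epsilon> + \<gamma> + \<mu>) \<parallel>w - wb\<parallel>\<close> for \<open>w \<in> \<Omega>\<close> near \<open>wb\<close>, which makes \<open>xs\<close> an
  \<open>(\<epsilon> + \<gamma> + \<mu>)\<close>-normal, and \<open>\<parallel>xb - wb\<parallel> \<le> t \<parallel>q\<parallel> + \<mu>\<close> is the required estimate once \<open>\<mu>\<close> is small.
\<close>

text \<open>The sets \<open>A u = {w \<in> S. f w + \<mu> d(u, w) \<le> f u}\<close> shrink as one passes from \<open>u\<close> to a point of
  \<open>A u\<close>, by the triangle inequality. Repeatedly passing to an almost-minimiser of \<open>f\<close> on the current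
  set makes their diameters tend to zero, so completeness yields a common point \<open>v\<close>; since \<open>A v\<close> is
  contained in all of these sets, it is \<open>{v}\<close>, and that is the claim.\<close>

theorem Ekeland_variational_principle:
  fixes f :: "'a::complete_space \<Rightarrow> real"
  assumes "closed S" and cont: "continuous_on S f" and bdd: "bdd_below (f ` S)"
    and "u0 \<in> S" and "0 < \<mu>"
  obtains v where "v \<in> S" "f v + \<mu> * dist u0 v \<le> f u0"
    "\<And>w. w \<in> S \<Longrightarrow> w \<noteq> v \<Longrightarrow> f v < f w + \<mu> * dist v w"
proof -
  define A where "A u = {w \<in> S. f w + \<mu> * dist u w \<le> f u}" for u
  have A_refl: "u \<in> A u" if "u \<in> S" for u
    using that by (simp add: A_def)
  have A_mono: "A w \<subseteq> A u" if "w \<in> A u" for u w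
  proof
    fix z assume z: "z \<in> A w"
    have "\<mu> * dist u z \<le> \<mu> * dist u w + \<mu> * dist w z"
      using mult_left_mono[OF dist_triangle[of u z w], of \<mu>] \<open>0 < \<mu>\<close>
      by (simp add: algebra_simps)
    with that z show "z \<in> A u"
      unfolding A_def by auto
  qed
  have A_closed: "closed (A u)" for u
    unfolding A_def
    by (intro continuous_on_closed_Collect_le \<open>closed S\<close> continuous_intros cont)
  have step: "\<exists>u'. u' \<in> S \<and> u' \<in> A u \<and> (\<forall>w\<in>A u. f u' < f w + \<mu> * (1/2)^n)"
    if "u \<in> S" for u and n :: nat
  proof -
    have ne: "f ` A u \<noteq> {}" using A_refl[OF that] by blast
    have bd: "bdd_below (f ` A u)"
      by (rule bdd_below_mono[OF bdd]) (auto simp: A_def)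
    have "Inf (f ` A u) < Inf (f ` A u) + \<mu> * (1/2)^n"
      using \<open>0 < \<mu>\<close> by simp
    then obtain u' where u': "u' \<in> A u" "f u' < Inf (f ` A u) + \<mu> * (1/2)^n"
      using cInf_lessD[OF ne] by blast
    moreover have "Inf (f ` A u) \<le> f w" if "w \<in> A u" for w
      using that bd by (intro cInf_lower) auto
    ultimately have "\<forall>w\<in>A u. f u' < f w + \<mu> * (1/2)^n"
      by force
    with u' show ?thesis
      unfolding A_def by blast
  qed
  have "\<exists>u. \<forall>n. (u n \<in> S \<and> (n = 0 \<longrightarrow> u n = u0)) \<and>
          (u (Suc n) \<in> A (u n) \<and> (\<forall>w\<in>A (u n). f (u (Suc n)) < f w + \<mu> * (1/2)^n))"
    using \<open>u0 \<in> S\<close> step by (intro dependent_nat_choice) auto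
  then obtain u where u0: "u 0 = u0" and u_S: "\<And>n. u n \<in> S"
    and u_Suc: "\<And>n. u (Suc n) \<in> A (u n)"
    and u_min: "\<And>n w. w \<in> A (u n) \<Longrightarrow> f (u (Suc n)) < f w + \<mu> * (1/2)^n"
    by metis
  have u_near: "dist (u (Suc n)) w < (1/2)^n" if "w \<in> A (u (Suc n))" for n w
  proof -
    have "\<mu> * dist (u (Suc n)) w < \<mu> * (1/2)^n"
      using that u_min[of w n] A_mono[OF u_Suc[of n]] unfolding A_def by force
    then show ?thesis using \<open>0 < \<mu>\<close> by simp
  qed
  have small: "\<exists>n. \<forall>x\<in>A (u n). \<forall>y\<in>A (u n). dist x y < e" if e: "0 < e" for e
  proof -
    obtain n where n: "(1/2)^n < e/2"
      using real_arch_pow_inv[of "e/2" "1/2"] e by auto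
    have "dist x y < e" if "x \<in> A (u (Suc n))" "y \<in> A (u (Suc n))" for x y
      using u_near[OF that(1)] u_near[OF that(2)] n
        dist_triangle[of x y "u (Suc n)"] by (simp add: dist_commute)
    then show ?thesis by blast
  qed
  have decr: "A (u n) \<subseteq> A (u m)" if "m \<le> n" for m n
    using lift_Suc_antimono_le[of "\<lambda>n. A (u n)", OF _ that] A_mono[OF u_Suc] by simp
  obtain v where v: "\<And>n. v \<in> A (u n)"
    by (rule decreasing_closed_nest[of "\<lambda>n. A (u n)"])
      (use A_closed A_refl u_S decr small in blast)+
  have v_unique: "w = v" if "w \<in> A v" for w
  proof (rule ccontr)
    assume "w \<noteq> v"
    then obtain n where "\<forall>x\<in>A (u n). \<forall>y\<in>A (u n). dist x y < dist w v"
      using small[of "dist w v"] by auto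
    moreover have "w \<in> A (u n)"
      using A_mono[OF v] that by blast
    ultimately show False using v by blast
  qed
  show thesis
  proof
    show "v \<in> S" "f v + \<mu> * dist u0 v \<le> f u0"
      using v[of 0] u0 by (auto simp: A_def)
    show "f v < f w + \<mu> * dist v w" if "w \<in> S" "w \<noteq> v" for w
      using v_unique[of w] that by (force simp: A_def)
  qed
qed

lemma minimal_time_le:
  assumes "0 \<le> t" "q \<in> F" "x + t *\<^sub>R q \<in> \<Omega>"
  shows "minimal_time F \<Omega> x \<le> ereal t"
  unfolding minimal_time_def using assms by (intro INF_lower) auto

lemma minimal_time_nonneg: "0 \<le> minimal_time F \<Omega> x"
  unfolding minimal_time_def by (auto intro!: INF_greatest)

lemma minimal_time_lessE:
  assumes "minimal_time F \<Omega> x < c"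
  obtains t q where "0 \<le> t" "ereal t < c" "q \<in> F" "x + t *\<^sub>R q \<in> \<Omega>"
proof -
  obtain t where "0 \<le> t" "\<Omega> \<inter> (\<lambda>q. x + t *\<^sub>R q) ` F \<noteq> {}" "ereal t < c"
    using assms unfolding minimal_time_def INF_less_iff by auto
  then show thesis using that by blast
qed

text \<open>The upper bound \<open>r\<close> stands in for \<open>\<phi> x\<close>, which may be infinite, so that the inequality
  is one between reals.\<close>

lemma eps_subdifferentialE:
  assumes "xs \<in> eps_subdifferential \<epsilon> \<phi> xb" and \<phi>: "\<phi> xb = ereal p" and "\<epsilon> < \<epsilon>'"
  obtains \<delta> where "0 < \<delta>"
    "\<And>x r. dist x xb < \<delta> \<Longrightarrow> \<phi> x \<le> ereal r \<Longrightarrow>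
       p + blinfun_apply xs (x - xb) \<le> r + \<epsilon>' * norm (x - xb)"
proof -
  let ?Q = "\<lambda>x. (\<phi> x - \<phi> xb - ereal (blinfun_apply xs (x - xb))) / ereal (norm (x - xb))"
  have "ereal (- \<epsilon>) \<le> Liminf (at xb) ?Q"
    using assms(1) \<phi> by (simp add: eps_subdifferential_def)
  then have "\<forall>\<^sub>F x in at xb. ereal (- \<epsilon>') < ?Q x"
    using \<open>\<epsilon> < \<epsilon>'\<close> unfolding le_Liminf_iff by simp
  then obtain \<delta> where "0 < \<delta>"
    and \<delta>: "\<And>x. x \<noteq> xb \<Longrightarrow> dist x xb < \<delta> \<Longrightarrow> ereal (- \<epsilon>') < ?Q x"
    unfolding eventually_at by blast
  have "p + blinfun_apply xs (x - xb) \<le> r + \<epsilon>' * norm (x - xb)"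
    if "dist x xb < \<delta>" "\<phi> x \<le> ereal r" for x r
  proof (cases "x = xb")
    case True
    then show ?thesis using that \<phi> by (simp add: zero_blinfun.rep_eq)
  next
    case False
    have less: "ereal (- \<epsilon>') < ?Q x" using \<delta> False that by blast
    show ?thesis
    proof (cases "\<phi> x")
      case (real a)
      then have "- \<epsilon>' < (a - p - blinfun_apply xs (x - xb)) / norm (x - xb)"
        using less \<phi> False by simp
      then show ?thesis
        using False that real by (simp add: field_simps)
    qed (use less that \<phi> False in auto)
  qed
  with \<open>0 < \<delta>\<close> show thesis using that by blast
qed

lemma eps_normalsI:
  assumes "w \<in> \<Theta>" "0 < \<delta>"
    and "\<And>x. x \<in> \<Theta> \<Longrightarrow> dist x w < \<delta> \<Longrightarrow> blinfun_apply xs (x - w) \<le> \<epsilon> * norm (x - w)"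
  shows "xs \<in> eps_normals \<epsilon> w \<Theta>"
proof -
  have "\<forall>\<^sub>F x in at w within \<Theta>. ereal (blinfun_apply xs (x - w) / norm (x - w)) \<le> ereal \<epsilon>"
    unfolding eventually_at using assms by (auto simp: field_simps intro!: exI[of _ \<delta>])
  then show ?thesis
    using \<open>w \<in> \<Theta>\<close> by (simp add: eps_normals_def Limsup_bounded)
qed

text \<open>This is where the approximate minimality of \<open>w0\<close> is traded for an approximate normal at a
  nearby point. The penalty \<open>\<epsilon> \<parallel>w - w0\<parallel>\<close> has Lipschitz constant \<open>\<epsilon>\<close>, so Ekeland's perturbation
  of slope \<open>\<mu>\<close> raises the constant of the normal to \<open>\<epsilon> + \<mu>\<close> only.\<close>

lemma eps_normal_near_approximate_minimiser:
  fixes \<Omega> :: "'a::banach set"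
  assumes "closed \<Omega>" "w0 \<in> \<Omega>" "0 \<le> \<epsilon>" "0 < \<mu>" "\<mu> < \<delta>"
    and approx: "\<And>w. w \<in> \<Omega> \<Longrightarrow> dist w w0 \<le> \<delta> \<Longrightarrow>
      blinfun_apply xs (w - w0) \<le> \<epsilon> * norm (w - w0) + \<mu>\<^sup>2"
  obtains wb where "wb \<in> \<Omega>" "dist w0 wb \<le> \<mu>" "xs \<in> eps_normals (\<epsilon> + \<mu>) wb \<Omega>"
proof -
  define f where "f w = \<epsilon> * norm (w - w0) - blinfun_apply xs (w - w0)" for w
  define S where "S = \<Omega> \<inter> cball w0 \<delta>"
  have f_lower: "- \<mu>\<^sup>2 \<le> f w" if "w \<in> S" for w
    using approx[of w] that by (auto simp: S_def f_def dist_commute)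
  have f_w0: "f w0 = 0" by (simp add: f_def)
  have S: "closed S" "w0 \<in> S"
    using assms by (auto simp: S_def)
  have "continuous_on S f"
    unfolding f_def by (intro continuous_intros)
  moreover have "bdd_below (f ` S)"
    using f_lower by (auto intro!: bdd_belowI)
  ultimately obtain wb where wb: "wb \<in> S" "f wb + \<mu> * dist w0 wb \<le> f w0"
    and min: "\<And>w. w \<in> S \<Longrightarrow> w \<noteq> wb \<Longrightarrow> f wb < f w + \<mu> * dist wb w"
    using Ekeland_variational_principle[OF S(1) _ _ S(2) \<open>0 < \<mu>\<close>] by metis
  have "\<mu> * dist w0 wb \<le> \<mu> * \<mu>"
    using wb f_lower[of wb] f_w0 by (simp add: power2_eq_square)
  then have near: "dist w0 wb \<le> \<mu>"
    using \<open>0 < \<mu>\<close> by simp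
  have "xs \<in> eps_normals (\<epsilon> + \<mu>) wb \<Omega>"
  proof (rule eps_normalsI)
    show "wb \<in> \<Omega>" using wb by (simp add: S_def)
    show "0 < \<delta> - \<mu>" using assms by simp
    fix w assume w: "w \<in> \<Omega>" "dist w wb < \<delta> - \<mu>"
    have "w \<in> S"
      using w near dist_triangle[of w0 w wb] by (simp add: S_def dist_commute)
    then have "f wb \<le> f w + \<mu> * dist wb w"
      using min[of w] by (cases "w = wb") auto
    moreover have "\<epsilon> * norm (w - w0) \<le> \<epsilon> * (norm (w - wb) + norm (wb - w0))"
      using norm_triangle_ineq[of "w - wb" "wb - w0"] \<open>0 \<le> \<epsilon>\<close>
      by (intro mult_left_mono) auto
    ultimately show "blinfun_apply xs (w - wb) \<le> (\<epsilon> + \<mu>) * norm (w - wb)"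
      by (simp add: f_def blinfun.diff_right dist_norm norm_minus_commute algebra_simps)
  qed
  with near wb show thesis using that by (auto simp: S_def)
qed

theorem theorem4p3:
  fixes \<Omega> F :: "'a::banach set" and xb :: 'a
  assumes "\<Omega> \<noteq> {}" and "closed \<Omega>"
    and "F \<noteq> {}" and "closed F" and "bounded F" and "convex F"
    and "xb \<notin> \<Omega>" and "minimal_time F \<Omega> xb < \<infinity>"
  shows "\<forall>\<epsilon>\<ge>0. \<forall>xs\<in>eps_subdifferential \<epsilon> (minimal_time F \<Omega>) xb. \<forall>\<eta>>0.
           \<exists>wb\<in>\<Omega>. xs \<in> eps_normals (\<epsilon> + \<eta>) wb \<Omega> \<and>
             ereal (norm (xb - wb)) \<le> ereal (set_norm F) * minimal_time F \<Omega> xb + ereal \<eta>"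
proof (intro allI impI ballI)
  fix \<epsilon> \<eta> :: real and xs
  assume \<epsilon>: "0 \<le> \<epsilon>" and xs: "xs \<in> eps_subdifferential \<epsilon> (minimal_time F \<Omega>) xb" and \<eta>: "0 < \<eta>"
  obtain T0 where T0: "minimal_time F \<Omega> xb = ereal T0"
    using assms(8) minimal_time_nonneg[of F \<Omega> xb] by (cases "minimal_time F \<Omega> xb") auto
  have le_norm: "norm q \<le> set_norm F" if "q \<in> F" for q
    unfolding set_norm_def
  proof (rule cSUP_upper[OF that])
    show "bdd_above (norm ` F)"
      using \<open>bounded F\<close> by (simp add: bdd_above_norm)
  qed
  have norm_nonneg: "0 \<le> set_norm F"
    using le_norm \<open>F \<noteq> {}\<close> norm_ge_zero order_trans by blast
  obtain \<delta> where \<delta>: "0 < \<delta>"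
    and sub: "\<And>x r. dist x xb < \<delta> \<Longrightarrow> minimal_time F \<Omega> x \<le> ereal r \<Longrightarrow>
       T0 + blinfun_apply xs (x - xb) \<le> r + (\<epsilon> + \<eta>/2) * norm (x - xb)"
    using eps_subdifferentialE[OF xs T0, of "\<epsilon> + \<eta>/2"] \<eta> by auto

  \<comment> \<open>The bounds serve, in order: \<open>\<mu>\<^sup>2 \<le> \<mu>\<close>; the second half of \<open>\<eta>\<close> in the constant of the normal;
    Ekeland's point stays strictly inside the ball of radius \<open>\<delta>/2\<close>; and the total excess
    \<open>\<mu>\<^sup>2 \<parallel>F\<parallel> + \<mu>\<close> in the distance is at most \<open>\<eta>\<close>.\<close>
  define \<mu> where "\<mu> = Min {1, \<eta>/2, \<delta>/4, \<eta> / (set_norm F + 1)}"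
  have "0 < \<mu>"
    using \<eta> \<delta> norm_nonneg by (simp add: \<mu>_def)
  moreover have "\<mu> \<le> 1" "\<mu> \<le> \<eta>/2" "\<mu> \<le> \<delta>/4" "\<mu> \<le> \<eta> / (set_norm F + 1)"
    unfolding \<mu>_def by (intro Min_le; simp)+
  ultimately have \<mu>: "0 < \<mu>" "\<mu> \<le> 1" "\<mu> \<le> \<eta>/2" "\<mu> < \<delta>/2" "\<mu> \<le> \<eta> / (set_norm F + 1)"
    using \<delta> by auto
  have \<mu>_sq: "\<mu>\<^sup>2 \<le> \<mu>"
    using \<mu> by (simp add: power2_eq_square)
  have \<mu>_norm: "\<mu> * set_norm F + \<mu> \<le> \<eta>"
    using \<mu>(5) norm_nonneg by (simp add: field_simps)

  have "minimal_time F \<Omega> xb < ereal (T0 + \<mu>\<^sup>2)"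
    using T0 \<mu> by simp
  then obtain t q where t: "0 \<le> t" "t < T0 + \<mu>\<^sup>2" and q: "q \<in> F" "xb + t *\<^sub>R q \<in> \<Omega>"
    by (elim minimal_time_lessE) auto
  define w0 where "w0 = xb + t *\<^sub>R q"
  have approx: "blinfun_apply xs (w - w0) \<le> (\<epsilon> + \<eta>/2) * norm (w - w0) + \<mu>\<^sup>2"
    if "w \<in> \<Omega>" "dist w w0 \<le> \<delta>/2" for w
  proof -
    have shift: "(w - t *\<^sub>R q) - xb = w - w0"
      by (simp add: w0_def)
    have "minimal_time F \<Omega> (w - t *\<^sub>R q) \<le> ereal t"
      using t q that by (intro minimal_time_le) auto
    moreover have "dist (w - t *\<^sub>R q) xb < \<delta>"
      using that \<delta> by (simp add: dist_norm shift)
    ultimately have "T0 + blinfun_apply xs (w - w0) \<le> t + (\<epsilon> + \<eta>/2) * norm (w - w0)"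
      using sub[of "w - t *\<^sub>R q" t] by (simp only: shift)
    then show ?thesis using t by simp
  qed
  have "w0 \<in> \<Omega>" "0 \<le> \<epsilon> + \<eta>/2"
    using q \<epsilon> \<eta> by (auto simp: w0_def)
  then obtain wb where wb: "wb \<in> \<Omega>" "dist w0 wb \<le> \<mu>"
    and normal: "xs \<in> eps_normals (\<epsilon> + \<eta>/2 + \<mu>) wb \<Omega>"
    using eps_normal_near_approximate_minimiser[OF \<open>closed \<Omega>\<close> _ _ \<mu>(1) \<mu>(4) approx] by metis
  have "ereal (\<epsilon> + \<eta>/2 + \<mu>) \<le> ereal (\<epsilon> + \<eta>)"
    using \<mu> by simp
  then have "xs \<in> eps_normals (\<epsilon> + \<eta>) wb \<Omega>"
    using normal wb unfolding eps_normals_def by (auto intro: order_trans)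
  moreover have "norm (xb - wb) \<le> set_norm F * T0 + \<eta>"
  proof -
    have "norm (xb - w0) = t * norm q"
      using t by (simp add: w0_def)
    also have "\<dots> \<le> (T0 + \<mu>) * set_norm F"
      using t \<mu>_sq le_norm[OF q(1)] by (intro mult_mono) auto
    finally have "norm (xb - w0) \<le> (T0 + \<mu>) * set_norm F" .
    then show ?thesis
      using wb(2) \<mu>_norm norm_triangle_ineq[of "xb - w0" "w0 - wb"]
      by (simp add: dist_norm algebra_simps)
  qed
  ultimately show "\<exists>wb\<in>\<Omega>. xs \<in> eps_normals (\<epsilon> + \<eta>) wb \<Omega> \<and>
      ereal (norm (xb - wb)) \<le> ereal (set_norm F) * minimal_time F \<Omega> xb + ereal \<eta>"
    using wb(1) T0 by auto
qed

end
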